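(* Let $p,q$ be integers with $q\geq p\geq 2$ and let $\lambda=(\alpha,\beta)\in\mathbb{R}^2$ satisfy $\alpha<\beta<\frac{\alpha}{2}<0$. Let $(M_\lambda,[g_\lambda])$ be the compact conformal manifold of type $(p,q)$ obtained as the quotient of $(\mathbb{R}^{p+q}\setminus\{0\},[g_0])$ by the group $\Gamma_\lambda$ generated by the conformal linear map $\varphi_\lambda$ (with $g_0$ and $\varphi_\lambda$ as defined in the context). Then the conformal group of $(M_\lambda,[g_\lambda])$ does not preserve any finite Borel measure on $M_\lambda$ which is nonzero on every nonempty open subset.
   Context: On $\mathbb{R}^{p+q}$ with coordinates $(x_1,\dots,x_{p+q})$, where $q=2+s$ with $s\ge 0$, let $$g_0=2\,dx_1dx_2+x_3^2\,dx_1^2+2\,dx_3dx_4+\sum_{j=5}^{p+q}\epsilon_j\,dx_j^2,$$ with $\epsilon_j=1$ for $5\le j\le 4+s$ and $\epsilon_j=-1$ for $j>4+s$ (the sum is empty when $p=q=2$). This is a pseudo-Riemannian metric of signature $(p,q)$ ($p$ negative and $q$ positive directions). For $\lambda=(\alpha,\beta)$ let $\varphi_\lambda$ be the linear map of $\mathbb{R}^{p+q}$ with diagonal matrix $$\varphi_\lambda=\mathrm{diag}(e^{-\alpha+2\beta},e^{3\alpha},e^{2\alpha-\beta},e^{3\beta},e^{\alpha+\beta},\dots,e^{\alpha+\beta}),$$ which satisfies $\varphi_\lambda^*g_0=e^{2(\alpha+\beta)}g_0$. When $\alpha<\beta<\frac{\alpha}{2}<0$ all diagonal entries lie in $(0,1)$,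 so the group $\Gamma_\lambda=\langle\varphi_\lambda\rangle$ acts freely and properly discontinuously on $\mathbb{R}^{p+q}\setminus\{0\}$, preserving the conformal class $[g_0]$; the quotient $M_\lambda=\Gamma_\lambda\backslash(\mathbb{R}^{p+q}\setminus\{0\})$ is a compact manifold which inherits a conformal structure $[g_\lambda]$ of type $(p,q)$, i.e. the unique one making the covering map $\mathbb{R}^{p+q}\setminus\{0\}\to M_\lambda$ locally conformal. The conformal class of a metric $g$ is $[g]=\{e^{2\sigma}g:\sigma \text{ smooth}\}$, and the conformal group of $(M_\lambda,[g_\lambda])$ is the group of all diffeomorphisms $f$ of $M_\lambda$ with $f^*[g_\lambda]=[g_\lambda]$. *)

theory Defs
  imports "HOL-Analysis.Analysis"
begin

section \<open>Smooth functions on open subsets of Euclidean space\<close>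

primrec Ck_on :: "nat \<Rightarrow> 'a::euclidean_space set \<Rightarrow> ('a \<Rightarrow> 'b::euclidean_space) \<Rightarrow> bool" where
  "Ck_on 0 S f \<longleftrightarrow> continuous_on S f"
| "Ck_on (Suc k) S f \<longleftrightarrow>
     (\<forall>x\<in>S. f differentiable (at x)) \<and> (\<forall>v. Ck_on k S (\<lambda>x. frechet_derivative f (at x) v))"

definition smooth_on :: "'a::euclidean_space set \<Rightarrow> ('a \<Rightarrow> 'b::euclidean_space) \<Rightarrow> bool" where
  "smooth_on S f \<longleftrightarrow> (\<forall>k. Ck_on k S f)"


section \<open>Manifolds given by an atlas\<close>

text \<open>A chart is a pair of its domain, an open set of the manifold, and its coordinate map;
  values of the coordinate map outside the domain are irrelevant.\<close>

type_synonym ('m, 'e) chart = "'m set \<times> ('m \<Rightarrow> 'e)"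

record ('m, 'e) charted_space =
  mtop :: "'m topology"
  atlas :: "('m, 'e) chart set"

abbreviation chart_image :: "('m, 'e) chart \<Rightarrow> 'e set" where
  "chart_image c \<equiv> snd c ` fst c"

definition chart_inv :: "('m, 'e) chart \<Rightarrow> 'e \<Rightarrow> 'm" where
  "chart_inv c = inv_into (fst c) (snd c)"

text \<open>The expression of a map in charts, and the set of coordinates on which it makes sense.\<close>

definition coord_rep :: "('m \<Rightarrow> 'n) \<Rightarrow> ('m, 'e) chart \<Rightarrow> ('n, 'f) chart \<Rightarrow> 'e \<Rightarrow> 'f" where
  "coord_rep f c c' = snd c' \<circ> f \<circ> chart_inv c"

definition coord_dom :: "('m \<Rightarrow> 'n) \<Rightarrow> ('m, 'e) chart \<Rightarrow> ('n, 'f) chart \<Rightarrow> 'e set" where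
  "coord_dom f c c' = snd c ` {m \<in> fst c. f m \<in> fst c'}"

definition smooth_map ::
  "('m, 'e::euclidean_space) charted_space \<Rightarrow> ('n, 'f::euclidean_space) charted_space
     \<Rightarrow> ('m \<Rightarrow> 'n) \<Rightarrow> bool" where
  "smooth_map X Y f \<longleftrightarrow> continuous_map (mtop X) (mtop Y) f \<and>
     (\<forall>c\<in>atlas X. \<forall>c'\<in>atlas Y. smooth_on (coord_dom f c c') (coord_rep f c c'))"

definition smooth_fun :: "('m, 'e::euclidean_space) charted_space \<Rightarrow> ('m \<Rightarrow> real) \<Rightarrow> bool" where
  "smooth_fun X \<sigma> \<longleftrightarrow> (\<forall>c\<in>atlas X. smooth_on (chart_image c) (\<sigma> \<circ> chart_inv c))"

definition diffeomorphism ::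
  "('m, 'e::euclidean_space) charted_space \<Rightarrow> ('m \<Rightarrow> 'm) \<Rightarrow> bool" where
  "diffeomorphism X f \<longleftrightarrow>
     bij_betw f (topspace (mtop X)) (topspace (mtop X)) \<and>
     smooth_map X X f \<and> smooth_map X X (inv_into (topspace (mtop X)) f)"


section \<open>Pseudo-Riemannian metrics and conformal classes\<close>

text \<open>A covariant 2-tensor field is given by its components in every chart:
  \<open>g c x v w\<close> is its value, in the coordinates of the chart \<open>c\<close>, at the point with coordinates
  \<open>x\<close> on the vectors \<open>v\<close>, \<open>w\<close>. Only charts of the atlas and points \<open>x\<close> in the image of
  the chart are relevant.\<close>

type_synonym ('m, 'e) tensor2 = "('m, 'e) chart \<Rightarrow> 'e \<Rightarrow> 'e \<Rightarrow> 'e \<Rightarrow> real"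

text \<open>\<open>is_pullback X Y f g' g\<close> expresses \<open>g = f\<^sup>* g'\<close>, as a relation because of the irrelevant
  values.\<close>

definition is_pullback ::
  "('m, 'e::euclidean_space) charted_space \<Rightarrow> ('n, 'f::euclidean_space) charted_space
     \<Rightarrow> ('m \<Rightarrow> 'n) \<Rightarrow> ('n, 'f) tensor2 \<Rightarrow> ('m, 'e) tensor2 \<Rightarrow> bool" where
  "is_pullback X Y f g' g \<longleftrightarrow>
     (\<forall>c\<in>atlas X. \<forall>c'\<in>atlas Y. \<forall>x\<in>coord_dom f c c'. \<forall>v w.
        g c x v w =
          g' c' (coord_rep f c c' x)
             (frechet_derivative (coord_rep f c c') (at x) v)
             (frechet_derivative (coord_rep f c c') (at x) w))"

text \<open>The last condition, with the identity as map, is the transformation rule of tensor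
  components under a change of charts.\<close>

definition pseudo_riemannian_metric ::
  "('m, 'e::euclidean_space) charted_space \<Rightarrow> ('m, 'e) tensor2 \<Rightarrow> bool" where
  "pseudo_riemannian_metric X g \<longleftrightarrow>
     (\<forall>c\<in>atlas X. \<forall>x\<in>chart_image c.
        bilinear (g c x) \<and> (\<forall>v w. g c x v w = g c x w v) \<and>
        (\<forall>v. (\<forall>w. g c x v w = 0) \<longrightarrow> v = 0)) \<and>
     (\<forall>c\<in>atlas X. \<forall>v w. smooth_on (chart_image c) (\<lambda>x. g c x v w)) \<and>
     is_pullback X X id g g"

definition conformal_class ::
  "('m, 'e::euclidean_space) charted_space \<Rightarrow> ('m, 'e) tensor2 \<Rightarrow> ('m, 'e) tensor2 set" where
  "conformal_class X g =
     {h. pseudo_riemannian_metric X h \<and>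
         (\<exists>\<sigma>. smooth_fun X \<sigma> \<and>
            (\<forall>c\<in>atlas X. \<forall>x\<in>chart_image c. \<forall>v w.
               h c x v w = exp (2 * \<sigma> (chart_inv c x)) * g c x v w))}"

definition pullback_class ::
  "('m, 'e::euclidean_space) charted_space \<Rightarrow> ('n, 'f::euclidean_space) charted_space
     \<Rightarrow> ('m \<Rightarrow> 'n) \<Rightarrow> ('n, 'f) tensor2 set \<Rightarrow> ('m, 'e) tensor2 set" where
  "pullback_class X Y f C = {h. \<exists>h'\<in>C. is_pullback X Y f h' h}"

definition conformal_group ::
  "('m, 'e::euclidean_space) charted_space \<Rightarrow> ('m, 'e) tensor2 set \<Rightarrow> ('m \<Rightarrow> 'm) set" where
  "conformal_group X C = {f. diffeomorphism X f \<and> pullback_class X X f C = C}"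


section \<open>Borel measures on a topological space\<close>

definition borel_measure_on :: "'m topology \<Rightarrow> 'm measure \<Rightarrow> bool" where
  "borel_measure_on T \<mu> \<longleftrightarrow> sets \<mu> = sets (sigma (topspace T) {U. openin T U})"

definition preserves_measure :: "'m measure \<Rightarrow> ('m \<Rightarrow> 'm) \<Rightarrow> bool" where
  "preserves_measure \<mu> f \<longleftrightarrow> f \<in> measurable \<mu> \<mu> \<and> distr \<mu> \<mu> f = \<mu>"


section \<open>The metric \<open>g\<^sub>0\<close> and the quotient manifold\<close>

text \<open>Coordinates on \<open>real ^ 'n\<close> are numbered by a bijection \<open>\<iota>\<close> from \<open>{1..CARD('n)}\<close>
  onto the index type: the coordinate \<open>x\<^sub>k\<close> is \<open>x $ \<iota> k\<close>. Here \<open>CARD('n) = p + q\<close>.\<close>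

text \<open>The manifold of nonzero vectors, with a single chart.\<close>

definition punctured_space :: "(real ^ 'n, real ^ 'n) charted_space" where
  "punctured_space = \<lparr>mtop = top_of_set (- {0}), atlas = {(- {0}, id)}\<rparr>"

definition eps :: "nat \<Rightarrow> nat \<Rightarrow> real" where
  "eps q j = (let s = q - 2 in if j \<le> 4 + s then 1 else - 1)"

text \<open>The polarized form of
  \<open>2 dx\<^sub>1 dx\<^sub>2 + x\<^sub>3\<^sup>2 dx\<^sub>1\<^sup>2 + 2 dx\<^sub>3 dx\<^sub>4 + \<Sum>\<^sub>j \<epsilon>\<^sub>j dx\<^sub>j\<^sup>2\<close>.\<close>

definition g0 :: "nat \<Rightarrow> nat \<Rightarrow> (nat \<Rightarrow> 'n) \<Rightarrow> (real ^ 'n, real ^ 'n) tensor2" where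
  "g0 p q \<iota> = (\<lambda>_ x v w.
     (v $ \<iota> 1 * w $ \<iota> 2 + v $ \<iota> 2 * w $ \<iota> 1) + (x $ \<iota> 3)\<^sup>2 * (v $ \<iota> 1 * w $ \<iota> 1)
     + (v $ \<iota> 3 * w $ \<iota> 4 + v $ \<iota> 4 * w $ \<iota> 3)
     + (\<Sum>j = 5..p + q. eps q j * (v $ \<iota> j * w $ \<iota> j)))"

definition weight :: "real \<Rightarrow> real \<Rightarrow> nat \<Rightarrow> real" where
  "weight \<alpha> \<beta> k =
     (if k = 1 then - \<alpha> + 2 * \<beta>
      else if k = 2 then 3 * \<alpha>
      else if k = 3 then 2 * \<alpha> - \<beta>
      else if k = 4 then 3 * \<beta>
      else \<alpha> + \<beta>)"

definition phi :: "real \<Rightarrow> real \<Rightarrow> (nat \<Rightarrow> 'n) \<Rightarrow> real ^ 'n \<Rightarrow> real ^ 'n" where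
  "phi \<alpha> \<beta> \<iota> x = (\<chi> i. exp (weight \<alpha> \<beta> (inv_into {1..CARD('n)} \<iota> i)) * x $ i)"

definition Gamma :: "real \<Rightarrow> real \<Rightarrow> (nat \<Rightarrow> 'n) \<Rightarrow> (real ^ 'n \<Rightarrow> real ^ 'n) set" where
  "Gamma \<alpha> \<beta> \<iota> = range (\<lambda>k. phi \<alpha> \<beta> \<iota> ^^ k) \<union> range (\<lambda>k. inv (phi \<alpha> \<beta> \<iota>) ^^ k)"

text \<open>Points of the quotient are orbits.\<close>

definition proj :: "real \<Rightarrow> real \<Rightarrow> (nat \<Rightarrow> 'n) \<Rightarrow> real ^ 'n \<Rightarrow> (real ^ 'n) set" where
  "proj \<alpha> \<beta> \<iota> x = (\<lambda>\<gamma>. \<gamma> x) ` Gamma \<alpha> \<beta> \<iota>"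

definition quotient_topology :: "'a topology \<Rightarrow> ('a \<Rightarrow> 'b) \<Rightarrow> 'b topology" where
  "quotient_topology T f =
     topology (\<lambda>U. U \<subseteq> f ` topspace T \<and> openin T {x \<in> topspace T. f x \<in> U})"

lemma openin_quotient_topology:
  "openin (quotient_topology T f) U \<longleftrightarrow>
     U \<subseteq> f ` topspace T \<and> openin T {x \<in> topspace T. f x \<in> U}"
proof -
  have "istopology (\<lambda>U. U \<subseteq> f ` topspace T \<and> openin T {x \<in> topspace T. f x \<in> U})"
    unfolding istopology_def
  proof (intro conjI allI impI)
    fix S U
    assume "S \<subseteq> f ` topspace T \<and> openin T {x \<in> topspace T. f x \<in> S}"
      and "U \<subseteq> f ` topspace T \<and> openin T {x \<in> topspace T. f x \<in> U}"
    moreover have "{x \<in> topspace T. f x \<in> S \<inter> U}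
        = {x \<in> topspace T. f x \<in> S} \<inter> {x \<in> topspace T. f x \<in> U}" by auto
    ultimately show "S \<inter> U \<subseteq> f ` topspace T" "openin T {x \<in> topspace T. f x \<in> S \<inter> U}"
      by auto
  next
    fix K
    assume K: "\<forall>U\<in>K. U \<subseteq> f ` topspace T \<and> openin T {x \<in> topspace T. f x \<in> U}"
    then show "\<Union>K \<subseteq> f ` topspace T" by blast
    have "{x \<in> topspace T. f x \<in> \<Union>K} = (\<Union>U\<in>K. {x \<in> topspace T. f x \<in> U})" by auto
    with K show "openin T {x \<in> topspace T. f x \<in> \<Union>K}" by auto
  qed
  then show ?thesis
    unfolding quotient_topology_def by (simp add: topology_inverse')
qed

lemma topspace_quotient_topology: "topspace (quotient_topology T f) = f ` topspace T"
proof -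
  have "{x \<in> topspace T. f x \<in> f ` topspace T} = topspace T" by auto
  then have "openin (quotient_topology T f) (f ` topspace T)"
    by (simp add: openin_quotient_topology)
  then show ?thesis
    by (metis openin_quotient_topology openin_subset openin_topspace subset_antisym)
qed

lemma quotient_map_quotient_topology: "quotient_map T (quotient_topology T f) f"
  by (simp add: quotient_map_def topspace_quotient_topology openin_quotient_topology)

text \<open>The charts of the quotient are the inverses of the projection restricted to those open
  sets of nonzero vectors on which it is injective.\<close>

definition M_quot :: "real \<Rightarrow> real \<Rightarrow> (nat \<Rightarrow> 'n) \<Rightarrow> ((real ^ 'n) set, real ^ 'n) charted_space" where
  "M_quot \<alpha> \<beta> \<iota> =
     \<lparr>mtop = quotient_topology (top_of_set (- {0})) (proj \<alpha> \<beta> \<iota>),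
      atlas = {(proj \<alpha> \<beta> \<iota> ` W, inv_into W (proj \<alpha> \<beta> \<iota>)) | W.
                 open W \<and> 0 \<notin> W \<and> inj_on (proj \<alpha> \<beta> \<iota>) W}\<rparr>"

text \<open>The conformal structure \<open>[g\<^sub>\<lambda>]\<close>: the metrics on the quotient for which the projection
  from the punctured space with \<open>[g\<^sub>0]\<close> is locally conformal.\<close>

definition conf_quot ::
  "nat \<Rightarrow> nat \<Rightarrow> real \<Rightarrow> real \<Rightarrow> (nat \<Rightarrow> 'n) \<Rightarrow> ((real ^ 'n) set, real ^ 'n) tensor2 set" where
  "conf_quot p q \<alpha> \<beta> \<iota> =
     {g. pseudo_riemannian_metric (M_quot \<alpha> \<beta> \<iota>) g \<and>
         (\<exists>h \<in> conformal_class punctured_space (g0 p q \<iota>).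
            is_pullback punctured_space (M_quot \<alpha> \<beta> \<iota>) (proj \<alpha> \<beta> \<iota>) g h)}"

end

theory Submission
  imports Defs
begin

text \<open>The diagonal maps \<open>phi a b\<close>, for all \<open>(a, b)\<close> and not only multiples of \<open>(\<alpha>, \<beta>)\<close>, are
  homotheties of \<open>g0\<close> and commute with each other, so each of them induces a conformal
  diffeomorphism of the quotient. In the logarithms of the first two coordinates, \<open>phi 0 1\<close> and
  the generator of the deck group are translations by the independent vectors \<open>(2, 0)\<close> and
  \<open>(2\<beta> - \<alpha>, 3\<alpha>)\<close>. Hence a small box in these coordinates projects to a nonempty open set that is
  wandering for the map induced by \<open>phi 0 1\<close>, and by Poincare recurrence a finite invariant measure
  vanishes on it.\<close>

section \<open>Smooth functions\<close>

text \<open>Being a derivative at \<open>x\<close> is a local property, so both maps have the same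
  candidates \<open>D\<close>. The equality therefore also covers points without a derivative, where
  \<open>frechet_derivative\<close> is an arbitrary choice.\<close>

lemma frechet_derivative_cong_open:
  assumes "open S" "x \<in> S" "\<And>y. y \<in> S \<Longrightarrow> f y = g y"
  shows "frechet_derivative f (at x) = frechet_derivative g (at x)"
    and "f differentiable (at x) \<longleftrightarrow> g differentiable (at x)"
proof -
  have eq: "(f has_derivative D) (at x) \<longleftrightarrow> (g has_derivative D) (at x)" for D
    using assms by (metis has_derivative_transform_within_open)
  show "frechet_derivative f (at x) = frechet_derivative g (at x)"
    unfolding frechet_derivative_def eq ..
  show "f differentiable (at x) \<longleftrightarrow> g differentiable (at x)"
    unfolding differentiable_def eq ..
qed

text \<open>Coordinate maps have arbitrary values outside their domains; this lets explicit formulas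
  on an open set replace them. Openness makes the derivatives agree as well, so the induction runs
  over both maps.\<close>

lemma Ck_on_cong:
  assumes "open S" "\<And>y. y \<in> S \<Longrightarrow> f y = g y" "Ck_on k S f"
  shows "Ck_on k S g"
  using assms(2,3)
proof (induction k arbitrary: f g)
  case 0
  then show ?case by (simp cong: continuous_on_cong)
next
  case (Suc k)
  note germ = frechet_derivative_cong_open[where f = f and g = g, OF assms(1) _ Suc.prems(1)]
  have "g differentiable (at x)" if "x \<in> S" for x
    using Suc.prems(2) germ(2)[OF that] that by simp
  moreover have "Ck_on k S (\<lambda>x. frechet_derivative g (at x) v)" for v
    by (rule Suc.IH[of "\<lambda>x. frechet_derivative f (at x) v"])
      (use Suc.prems germ(1) in auto)
  ultimately show ?case by simp
qed

lemma Ck_on_subset: "Ck_on k S f \<Longrightarrow> T \<subseteq> S \<Longrightarrow> Ck_on k T f"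
  by (induction k arbitrary: f) (auto intro: continuous_on_subset)

lemma Ck_on_add_const: "Ck_on k S f \<Longrightarrow> Ck_on k S (\<lambda>x. f x + c)"
proof (cases k)
  case 0
  then show "Ck_on k S f \<Longrightarrow> ?thesis" by (simp add: continuous_on_add)
next
  case (Suc l)
  have eq: "((\<lambda>x. f x + c) has_derivative D) (at x) \<longleftrightarrow> (f has_derivative D) (at x)" for D x
    using has_derivative_diff[OF _ has_derivative_const[of c "at x"], of "\<lambda>x. f x + c" D]
      has_derivative_add[OF _ has_derivative_const[of c "at x"], of f D] by auto
  show "Ck_on k S f \<Longrightarrow> ?thesis"
    by (simp add: Suc frechet_derivative_def differentiable_def eq)
qed

text \<open>The derivative of the composite in direction \<open>v\<close> is the derivative of
  \<open>f\<close> in the fixed direction \<open>L v\<close>, again composed with \<open>L\<close>,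
  so the induction hypothesis applies to it.\<close>

lemma Ck_on_compose_linear:
  fixes L :: "'a::euclidean_space \<Rightarrow> 'c::euclidean_space"
  assumes "linear L" "L ` S \<subseteq> T" "open S" "Ck_on k T f"
  shows "Ck_on k S (\<lambda>x. f (L x))"
  using assms(4)
proof (induction k arbitrary: f)
  case 0
  have "continuous_on S L"
    using assms(1) by (simp add: linear_continuous_on linear_linear)
  with 0 assms(2) show ?case
    by (auto intro: continuous_on_compose2)
next
  case (Suc k)
  have D: "((\<lambda>x. f (L x)) has_derivative (\<lambda>v. frechet_derivative f (at (L x)) (L v))) (at x)"
    if "x \<in> S" for x
  proof (rule has_derivative_compose[where f = L and g = f])
    show "(L has_derivative L) (at x)"
      using assms(1) by (simp add: linear_imp_has_derivative)
    show "(f has_derivative frechet_derivative f (at (L x))) (at (L x))"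
      using Suc.prems assms(2) that by (auto simp: frechet_derivative_works)
  qed
  have "Ck_on k S (\<lambda>x. frechet_derivative (\<lambda>x. f (L x)) (at x) v)" for v
  proof (rule Ck_on_cong[OF assms(3)])
    show "Ck_on k S (\<lambda>x. frechet_derivative f (at (L x)) (L v))"
      using Suc.IH[of "\<lambda>y. frechet_derivative f (at y) (L v)"] Suc.prems by simp
    show "frechet_derivative f (at (L y)) (L v) = frechet_derivative (\<lambda>x. f (L x)) (at y) v"
      if "y \<in> S" for y
      using frechet_derivative_at[OF D[OF that]] by metis
  qed
  then show ?case
    using D by (auto simp: differentiable_def)
qed

text \<open>A locally affine map has one and the same derivative near each point, so its directional
  derivatives are locally constant, hence locally affine again. Allowing the constant
  \<open>c\<close> is what closes the induction.\<close>

lemma Ck_on_locally_affine: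
  assumes "\<And>x. x \<in> S \<Longrightarrow>
    \<exists>U L c. open U \<and> x \<in> U \<and> linear L \<and> (\<forall>y\<in>U. f y = L y + c)"
  shows "Ck_on k S f"
  using assms
proof (induction k arbitrary: f)
  have D: "\<exists>U L. open U \<and> x \<in> U \<and> linear L \<and> (\<forall>y\<in>U. (f has_derivative L) (at y))"
    if f: "\<And>x. x \<in> S \<Longrightarrow> \<exists>U L c. open U \<and> x \<in> U \<and> linear L \<and> (\<forall>y\<in>U. f y = L y + c)"
      and "x \<in> S" for f :: "'a \<Rightarrow> 'b" and x
  proof -
    obtain U L c where U: "open U" "x \<in> U" "linear L" "\<forall>y\<in>U. f y = L y + c"
      using f[OF \<open>x \<in> S\<close>] by blast
    have "(f has_derivative L) (at y)" if "y \<in> U" for y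
    proof (rule has_derivative_transform_within_open)
      show "((\<lambda>y. L y + c) has_derivative L) (at y)"
        using has_derivative_add[OF linear_imp_has_derivative[OF U(3)] has_derivative_const[of c "at y"]]
        by simp
    qed (use U that in auto)
    with U show ?thesis by blast
  qed
  {
    case 0
    then have "f differentiable (at x)" if "x \<in> S" for x
      using D[OF 0 that] by (auto simp: differentiable_def)
    then show ?case
      by (simp add: continuous_at_imp_continuous_on differentiable_imp_continuous_within)
  next
    case (Suc k)
    have "Ck_on k S (\<lambda>x. frechet_derivative f (at x) v)" for v
    proof (rule Suc.IH)
      fix x assume "x \<in> S"
      then obtain U L where U: "open U" "x \<in> U" "\<forall>y\<in>U. (f has_derivative L) (at y)"
        using D[OF Suc.prems] by metis
      \<comment> \<open>The summand \<open>0\<close> is the zero linear part of the affine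
        pattern.\<close>
      have "\<forall>y\<in>U. frechet_derivative f (at y) v = 0 + L v"
        using U(3) frechet_derivative_at by (metis add_0)
      with U show "\<exists>U L c. open U \<and> x \<in> U \<and> linear L \<and>
          (\<forall>y\<in>U. frechet_derivative f (at y) v = L y + c)"
        using module_hom_zero by (intro exI[of _ U] exI[of _ "\<lambda>_. 0"] exI[of _ "L v"]) (auto simp: linear_iff)
    qed
    moreover have "f differentiable (at x)" if "x \<in> S" for x
      using D[OF Suc.prems that] by (auto simp: differentiable_def)
    ultimately show ?case by simp
  }
qed

section \<open>The diagonal maps\<close>

lemma weight_add: "weight (a + c) (b + d) k = weight a b k + weight c d k"
  by (simp add: weight_def algebra_simps)

text \<open>Weights are additive in \<open>(a, b)\<close>, so \<open>phi\<close> is an action of the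
  additive group of the plane; inverses, commutation and powers come from this law.\<close>

lemma phi_add: "phi (a + c) (b + d) \<iota> x = phi a b \<iota> (phi c d \<iota> x)"
  by (simp add: phi_def weight_add exp_add vec_eq_iff)

lemma phi_0 [simp]: "phi 0 0 \<iota> x = x"
  by (simp add: phi_def weight_def vec_eq_iff)

lemma phi_cancel [simp]:
  "phi (- a) (- b) \<iota> (phi a b \<iota> x) = x" "phi a b \<iota> (phi (- a) (- b) \<iota> x) = x"
  using phi_add[of "- a" a "- b" b \<iota> x] phi_add[of a "- a" b "- b" \<iota> x] by simp_all

lemma phi_commute: "phi a b \<iota> (phi c d \<iota> x) = phi c d \<iota> (phi a b \<iota> x)"
  by (metis phi_add add.commute)

lemma linear_phi: "linear (phi a b \<iota>)"
  by (rule linearI) (simp_all add: phi_def vec_eq_iff algebra_simps)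

lemma phi_eq_0_iff [simp]: "phi a b \<iota> x = 0 \<longleftrightarrow> x = 0"
  by (metis phi_cancel(1) linear_0 linear_phi)

lemma inv_phi: "inv (phi a b \<iota>) = phi (- a) (- b) \<iota>"
  by (rule inv_equality) simp_all

lemma phi_funpow: "(phi a b \<iota> ^^ k) x = phi (of_nat k * a) (of_nat k * b) \<iota> x"
proof (induction k)
  case (Suc k)
  then show ?case
    by (simp add: phi_add[symmetric] algebra_simps)
qed simp

lemma Gamma_eq: "Gamma a b \<iota> = range (\<lambda>t::int. phi (of_int t * a) (of_int t * b) \<iota>)"
proof -
  let ?R = "range (\<lambda>t::int. phi (of_int t * a) (of_int t * b) \<iota>)"
  have pos: "phi a b \<iota> ^^ k = phi (of_int (int k) * a) (of_int (int k) * b) \<iota>" for k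
    by (simp add: phi_funpow fun_eq_iff)
  have neg: "inv (phi a b \<iota>) ^^ k = phi (of_int (- int k) * a) (of_int (- int k) * b) \<iota>" for k
    by (simp add: inv_phi phi_funpow fun_eq_iff)
  show ?thesis
    unfolding Gamma_def pos neg
  proof (intro equalityI Un_least subsetI)
    fix f assume "f \<in> ?R"
    then obtain t :: int where t: "f = phi (of_int t * a) (of_int t * b) \<iota>" by blast
    \<comment> \<open>Powers of the map cover \<open>t \<ge> 0\<close>, powers of its inverse
      \<open>t \<le> 0\<close>. The deleted simp rules would destroy the shapes
      \<open>of_int (int k)\<close> and \<open>of_int (- int k)\<close>.\<close>
    show "f \<in> range (\<lambda>k. phi (of_int (int k) * a) (of_int (int k) * b) \<iota>)
        \<union> range (\<lambda>k. phi (of_int (- int k) * a) (of_int (- int k) * b) \<iota>)"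
      using t by (cases t rule: int_cases2) (auto simp del: of_int_of_nat_eq of_int_minus)
  qed blast+
qed

lemma phi_nth:
  assumes "bij_betw \<iota> {1..CARD('n)} (UNIV :: 'n::finite set)" "k \<in> {1..CARD('n)}"
  shows "phi a b \<iota> x $ \<iota> k = exp (weight a b k) * x $ \<iota> k"
  using assms by (simp add: phi_def bij_betw_def inv_into_f_f)

text \<open>Every monomial of \<open>g0\<close>, base point included, scales by
  \<open>exp (2 * (a + b))\<close>: the exponents are \<open>(2b - a) + 3a\<close>,
  \<open>(2a - b) + 3b\<close>, \<open>2(2a - b) + 2(2b - a)\<close> and twice
  \<open>a + b\<close>.\<close>

lemma g0_phi:
  assumes "bij_betw \<iota> {1..CARD('n)} (UNIV :: 'n::finite set)" "CARD('n) = p + q" "4 \<le> p + q"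
  shows "g0 p q \<iota> c (phi a b \<iota> x) (phi a b \<iota> v) (phi a b \<iota> w) = exp (2 * (a + b)) * g0 p q \<iota> c x v w"
proof -
  note nth = phi_nth[OF assms(1)]
  have nth': "phi a b \<iota> y $ \<iota> 1 = exp (2 * b - a) * y $ \<iota> 1"
    "phi a b \<iota> y $ \<iota> 2 = exp (3 * a) * y $ \<iota> 2"
    "phi a b \<iota> y $ \<iota> 3 = exp (2 * a - b) * y $ \<iota> 3"
    "phi a b \<iota> y $ \<iota> 4 = exp (3 * b) * y $ \<iota> 4" for y
    using assms by (auto simp: nth weight_def)
  have e: "exp (2 * b - a) * exp (3 * a) = exp (2 * (a + b))"
    "exp (2 * a - b) * exp (3 * b) = exp (2 * (a + b))"
    "(exp (2 * a - b))\<^sup>2 * (exp (2 * b - a) * exp (2 * b - a)) = exp (2 * (a + b))"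
    "exp (a + b) * exp (a + b) = exp (2 * (a + b))"
    by (simp_all add: exp_add[symmetric] power2_eq_square)
  have n5: "phi a b \<iota> y $ \<iota> j = exp (a + b) * y $ \<iota> j" if "j \<in> {5..p + q}" for j y
    using assms that by (auto simp: nth weight_def)
  have s: "(\<Sum>j = 5..p + q. eps q j * (phi a b \<iota> v $ \<iota> j * phi a b \<iota> w $ \<iota> j))
      = exp (2 * (a + b)) * (\<Sum>j = 5..p + q. eps q j * (v $ \<iota> j * w $ \<iota> j))"
    unfolding sum_distrib_left e(4)[symmetric]
    by (rule sum.cong[OF refl]) (simp only: n5 mult_ac)
  have t12: "phi a b \<iota> v $ \<iota> 1 * phi a b \<iota> w $ \<iota> 2 + phi a b \<iota> v $ \<iota> 2 * phi a b \<iota> w $ \<iota> 1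
     = exp (2 * (a + b)) * (v $ \<iota> 1 * w $ \<iota> 2 + v $ \<iota> 2 * w $ \<iota> 1)"
    unfolding nth' e(1)[symmetric] by (simp only: algebra_simps)
  have t34: "phi a b \<iota> v $ \<iota> 3 * phi a b \<iota> w $ \<iota> 4 + phi a b \<iota> v $ \<iota> 4 * phi a b \<iota> w $ \<iota> 3
     = exp (2 * (a + b)) * (v $ \<iota> 3 * w $ \<iota> 4 + v $ \<iota> 4 * w $ \<iota> 3)"
    unfolding nth' e(2)[symmetric] by (simp only: algebra_simps)
  have t11: "(phi a b \<iota> x $ \<iota> 3)\<^sup>2 * (phi a b \<iota> v $ \<iota> 1 * phi a b \<iota> w $ \<iota> 1)
     = exp (2 * (a + b)) * ((x $ \<iota> 3)\<^sup>2 * (v $ \<iota> 1 * w $ \<iota> 1))"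
    unfolding nth' e(3)[symmetric] by (simp only: power_mult_distrib mult_ac)
  show ?thesis
    unfolding g0_def s t12 t34 t11 by (simp only: distrib_left)
qed


section \<open>The quotient manifold\<close>

locale conformal_quotient =
  fixes p q :: nat and \<alpha> \<beta> :: real and \<iota> :: "nat \<Rightarrow> 'n::finite"
  assumes p_ge: "2 \<le> p" and p_le_q: "p \<le> q"
    and card_n: "CARD('n) = p + q" and bij_coords: "bij_betw \<iota> {1..p + q} (UNIV :: 'n set)"
    and less: "\<alpha> < \<beta>" "\<beta> < \<alpha> / 2" "\<alpha> / 2 < 0"
begin

abbreviation M :: "((real ^ 'n) set, real ^ 'n) charted_space" where
  "M \<equiv> M_quot \<alpha> \<beta> \<iota>"

abbreviation P :: "(real ^ 'n, real ^ 'n) charted_space" where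
  "P \<equiv> punctured_space"

abbreviation \<pi> :: "real ^ 'n \<Rightarrow> (real ^ 'n) set" where
  "\<pi> \<equiv> proj \<alpha> \<beta> \<iota>"

abbreviation \<Phi> :: "real \<Rightarrow> real \<Rightarrow> real ^ 'n \<Rightarrow> real ^ 'n" where
  "\<Phi> a b \<equiv> phi a b \<iota>"

section \<open>Deck transformations and orbits\<close>

definition deck :: "int \<Rightarrow> real ^ 'n \<Rightarrow> real ^ 'n" where
  "deck t = \<Phi> (of_int t * \<alpha>) (of_int t * \<beta>)"

lemma bij_coords': "bij_betw \<iota> {1..CARD('n)} (UNIV :: 'n set)"
  using bij_coords card_n by simp

lemma deck_0 [simp]: "deck 0 x = x"
  by (simp add: deck_def)

lemma deck_add: "deck (s + t) x = deck s (deck t x)"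
  by (simp add: deck_def phi_add[symmetric] distrib_right)

lemma linear_deck: "linear (deck t)"
  unfolding deck_def by (rule linear_phi)

lemma deck_eq_0_iff [simp]: "deck t x = 0 \<longleftrightarrow> x = 0"
  by (simp add: deck_def)

lemma deck_phi: "deck t (\<Phi> a b x) = \<Phi> a b (deck t x)"
  unfolding deck_def by (rule phi_commute)

lemma proj_eq: "\<pi> x = range (\<lambda>t. deck t x)"
  by (auto simp: proj_def Gamma_eq deck_def)

lemma proj_eq_iff: "\<pi> x = \<pi> y \<longleftrightarrow> (\<exists>t. y = deck t x)"
proof
  assume "\<pi> x = \<pi> y"
  moreover have "y \<in> \<pi> y"
    unfolding proj_eq by (metis deck_0 rangeI)
  ultimately show "\<exists>t. y = deck t x"
    by (auto simp: proj_eq)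
next
  assume "\<exists>t. y = deck t x"
  then obtain t where y: "y = deck t x" ..
  have "deck s x = deck (s - t) y" for s
    by (simp add: y deck_add[symmetric])
  moreover have "deck s y = deck (s + t) x" for s
    by (simp add: y deck_add)
  ultimately show "\<pi> x = \<pi> y"
    unfolding proj_eq by (metis (no_types, lifting) equalityI image_subsetI rangeI)
qed

lemma proj_deck [simp]: "\<pi> (deck t x) = \<pi> x"
  using proj_eq_iff by metis

text \<open>The first weight is negative by \<beta> < \<alpha>/2, the third because 2\<alpha> -
  \<beta> < \<alpha> < 0, the others because \<alpha> and \<beta> are negative. Hence any nonzero
  coordinate of a vector distinguishes it from its translates.\<close>

lemma weight_neg: "weight \<alpha> \<beta> k < 0"
  using less by (auto simp: weight_def)

lemma topspace_M: "topspace (mtop M) = \<pi> ` (- {0})"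
  by (simp add: M_quot_def topspace_quotient_topology)

text \<open>The saturation of \<open>U\<close> is the union of its preimages under the deck maps,
  and these are open by continuity.\<close>

lemma openin_M_proj:
  assumes "open U" "0 \<notin> U"
  shows "openin (mtop M) (\<pi> ` U)"
proof -
  have "{x \<in> - {0}. \<pi> x \<in> \<pi> ` U} = (\<Union>t. deck t -` U)"
    using assms(2) by (auto simp: image_iff proj_eq_iff) (metis deck_eq_0_iff)+
  moreover have "open (\<Union>t. deck t -` U)"
    using assms(1)
    by (auto intro!: open_vimage simp: linear_continuous_on linear_linear linear_deck)
  ultimately have "openin (top_of_set (- {0})) {x \<in> - {0}. \<pi> x \<in> \<pi> ` U}"
    by (intro open_subset) auto
  then show ?thesis
    using assms(2) by (auto simp: M_quot_def openin_quotient_topology)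
qed

section \<open>Slices and their charts\<close>

definition slice :: "(real ^ 'n) set \<Rightarrow> bool" where
  "slice W \<longleftrightarrow> open W \<and> 0 \<notin> W \<and> inj_on \<pi> W"

text \<open>The charts of \<open>M_quot\<close> are local sections of the projection over images of
  slices.\<close>

definition slice_chart :: "(real ^ 'n) set \<Rightarrow> ((real ^ 'n) set, real ^ 'n) chart" where
  "slice_chart W = (\<pi> ` W, inv_into W \<pi>)"

lemma atlas_M: "atlas M = slice_chart ` {W. slice W}"
  by (auto simp: M_quot_def slice_chart_def slice_def)

lemma atlas_P: "atlas P = {(- {0}, id)}"
  by (simp add: punctured_space_def)

lemma chart_image_slice:
  assumes "slice W"
  shows "chart_image (slice_chart W) = W"
  using assms by (auto simp: slice_chart_def slice_def image_image inv_into_f_f)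

text \<open>Here \<open>chart_inv\<close> is an \<open>inv_into\<close> of an
  \<open>inv_into\<close>; it collapses because the inner one is injective on the image of
  \<open>W\<close> and takes \<open>\<pi> x\<close> back to \<open>x\<close>.\<close>

lemma chart_inv_slice:
  assumes "slice W" "x \<in> W"
  shows "chart_inv (slice_chart W) x = \<pi> x"
proof -
  have "inj_on (inv_into W \<pi>) (\<pi> ` W)"
    by (simp add: inj_on_inv_into)
  moreover have "x = inv_into W \<pi> (\<pi> x)"
    using assms by (simp add: slice_def inv_into_f_f)
  ultimately show ?thesis
    using assms by (metis chart_inv_def fst_conv image_eqI inv_into_f_f slice_chart_def snd_conv)
qed

lemma inv_into_slice:
  assumes "slice W" "deck t x \<in> W"
  shows "inv_into W \<pi> (\<pi> x) = deck t x"
  using assms inv_into_f_f[of \<pi> W "deck t x"] by (simp add: slice_def)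

text \<open>A deck map translates the logarithm of a nonzero coordinate by a multiple of its weight
  \<kappa>, so a logarithmic window of length -\<kappa> meets each orbit at most once.\<close>

lemma slice_around:
  assumes "x \<noteq> 0"
  obtains W where "slice W" "x \<in> W"
proof -
  obtain i where i: "x $ i \<noteq> 0"
    using assms by (auto simp: vec_eq_iff)
  define \<kappa> where "\<kappa> = weight \<alpha> \<beta> (inv_into {1..CARD('n)} \<iota> i)"
  have \<kappa>: "\<kappa> < 0"
    unfolding \<kappa>_def by (rule weight_neg)
  have deck_i: "deck t y $ i = exp (of_int t * \<kappa>) * y $ i" for t y
  proof -
    have "weight (of_int t * \<alpha>) (of_int t * \<beta>) k = of_int t * weight \<alpha> \<beta> k" for k
      by (simp add: weight_def algebra_simps)
    then show ?thesis by (simp add: deck_def phi_def \<kappa>_def)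
  qed
  \<comment> \<open>In the logarithm of \<open>y $ i / x $ i\<close> this is the open interval of
    length -\<kappa> centred at 0, the value at \<open>x\<close>.\<close>
  define W where "W = {y :: real ^ 'n. exp (\<kappa> / 2) < y $ i / x $ i \<and> y $ i / x $ i < exp (- \<kappa> / 2)}"
  have "open W"
    unfolding W_def by (intro open_Collect_conj open_Collect_less continuous_intros) (use i in auto)
  moreover have "0 \<notin> W"
    by (simp add: W_def)
  moreover have "inj_on \<pi> W"
  proof (rule inj_onI)
    fix y z assume y: "y \<in> W" and z: "z \<in> W" and "\<pi> y = \<pi> z"
    then obtain t where t: "z = deck t y"
      by (auto simp: proj_eq_iff)
    define r where "r = ln (y $ i / x $ i)"
    have pos: "0 < y $ i / x $ i"
      using y by (auto simp: W_def intro: less_trans[OF exp_gt_zero])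
    then have r: "y $ i / x $ i = exp r"
      by (simp add: r_def)
    have "z $ i / x $ i = exp (of_int t * \<kappa> + r)"
      by (simp add: t deck_i exp_add flip: r)
    with y z r have "\<kappa> / 2 < r" "r < - \<kappa> / 2" "\<kappa> / 2 < of_int t * \<kappa> + r" "of_int t * \<kappa> + r < - \<kappa> / 2"
      by (simp_all add: W_def)
    \<comment> \<open>Two points of the window differ by less than -\<kappa>. The factors
      \<open>1\<close> and \<open>- 1\<close> are written out so that the negative \<kappa> can be
      cancelled.\<close>
    then have "of_int t * \<kappa> < - 1 * \<kappa>" "1 * \<kappa> < of_int t * \<kappa>" by linarith+
    with \<kappa> have "(of_int t :: real) < 1" "- 1 < (of_int t :: real)"
      unfolding mult_less_cancel_right by auto
    then have "t = 0" by linarith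
    with t show "y = z" by simp
  qed
  ultimately have "slice W" by (simp add: slice_def)
  moreover have "x \<in> W"
    using i \<kappa> by (simp add: W_def)
  ultimately show ?thesis using that by blast
qed

subsection \<open>Maps in charts\<close>

text \<open>The condition is restricted to nonzero vectors because the orbit of zero is not a point
  of the quotient; an \<open>inv_into\<close> on the topspace can then have a lift too.\<close>

definition lifts_to :: "((real ^ 'n) set \<Rightarrow> (real ^ 'n) set) \<Rightarrow> (real ^ 'n \<Rightarrow> real ^ 'n) \<Rightarrow> bool" where
  "lifts_to F L \<longleftrightarrow> (\<forall>x. x \<noteq> 0 \<longrightarrow> F (\<pi> x) = \<pi> (L x))"

text \<open>The lift \<open>L x\<close> may miss \<open>W'\<close> although its orbit meets it,
  hence the deck translate.\<close>

lemma coord_dom_slice: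
  assumes "slice W" "lifts_to F L"
  shows "coord_dom F (slice_chart W) (slice_chart W') = {x \<in> W. \<exists>t. deck t (L x) \<in> W'}"
proof -
  have inv: "inv_into W \<pi> (\<pi> x) = x" if "x \<in> W" for x
    using assms(1) that by (simp add: slice_def inv_into_f_f)
  have F: "F (\<pi> x) = \<pi> (L x)" if "x \<in> W" for x
    using assms that by (metis lifts_to_def slice_def)
  have mem: "\<pi> (L x) \<in> \<pi> ` W' \<longleftrightarrow> (\<exists>t. deck t (L x) \<in> W')" for x
    by (auto simp: proj_eq_iff image_iff)
  have "coord_dom F (slice_chart W) (slice_chart W') = inv_into W \<pi> ` \<pi> ` {x \<in> W. F (\<pi> x) \<in> \<pi> ` W'}"
    unfolding coord_dom_def slice_chart_def fst_conv snd_conv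
    by (rule arg_cong[where f = "image _"]) auto
  also have "\<dots> = {x \<in> W. F (\<pi> x) \<in> \<pi> ` W'}"
    by (force simp: inv)
  finally show ?thesis
    by (simp add: F mem cong: conj_cong)
qed

lemma coord_rep_slice:
  assumes "slice W" "slice W'" "lifts_to F L"
    and "x \<in> W" "deck t (L x) \<in> W'"
  shows "coord_rep F (slice_chart W) (slice_chart W') x = deck t (L x)"
proof -
  have "x \<noteq> 0" using assms by (auto simp: slice_def)
  have "coord_rep F (slice_chart W) (slice_chart W') x = inv_into W' \<pi> (F (\<pi> x))"
    using chart_inv_slice[OF assms(1,4)] by (simp add: coord_rep_def slice_chart_def)
  also have "\<dots> = deck t (L x)"
    using assms(3) \<open>x \<noteq> 0\<close> inv_into_slice[OF assms(2,5)] by (simp add: lifts_to_def)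
  finally show ?thesis .
qed

text \<open>On this set, with \<open>t\<close> fixed, the coordinate representation is the linear
  map \<open>deck t\<close> after \<open>L\<close>, so derivatives can be read off there.\<close>

lemma open_slice_vimage:
  assumes "slice W" "slice W'" "linear L"
  shows "open {y \<in> W. deck t (L y) \<in> W'}"
proof -
  have "continuous_on UNIV (\<lambda>y. deck t (L y))"
    using linear_compose[OF assms(3) linear_deck[of t]]
    by (simp add: o_def linear_continuous_on linear_linear)
  then have "open (W \<inter> (\<lambda>y. deck t (L y)) -` W')"
    using assms by (auto intro!: open_Int open_vimage simp: slice_def)
  then show ?thesis by (simp add: vimage_def Int_def)
qed

lemma frechet_derivative_coord_rep_slice:
  assumes "slice W" "slice W'" "lifts_to F L" "linear L"
    and "x \<in> W" "deck t (L x) \<in> W'"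
  shows "frechet_derivative (coord_rep F (slice_chart W) (slice_chart W')) (at x) = (\<lambda>v. deck t (L v))"
proof -
  have "((\<lambda>v. deck t (L v)) has_derivative (\<lambda>v. deck t (L v))) (at x)"
    using linear_imp_has_derivative[OF linear_compose[OF assms(4) linear_deck[of t]]]
    by (simp add: o_def)
  then have "(coord_rep F (slice_chart W) (slice_chart W') has_derivative (\<lambda>v. deck t (L v))) (at x)"
    by (rule has_derivative_transform_within_open[OF _ open_slice_vimage[OF assms(1,2,4), of t]])
      (use assms coord_rep_slice[OF assms(1,2,3)] in auto)
  then show ?thesis
    using frechet_derivative_at by metis
qed

text \<open>Continuity is the universal property of the quotient map; smoothness holds because the
  coordinate representations are locally linear, with \<open>t\<close> depending on the
  point.\<close>

lemma smooth_map_descend: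
  assumes "lifts_to F L" "linear L" "\<And>x. L x = 0 \<Longrightarrow> x = 0"
  shows "smooth_map M M F"
  unfolding smooth_map_def
proof (intro conjI ballI)
  let ?T = "top_of_set (- {0 :: real ^ 'n})"
  have "continuous_map ?T ?T L"
    using assms by (auto simp: linear_continuous_on linear_linear)
  then have "continuous_map ?T (mtop M) (\<pi> \<circ> L)"
    using quotient_imp_continuous_map[OF quotient_map_quotient_topology, of ?T \<pi>]
    unfolding M_quot_def charted_space.simps by (rule continuous_map_compose)
  then have "continuous_map ?T (mtop M) (F \<circ> \<pi>)"
    by (rule continuous_map_eq) (use assms(1) in \<open>simp add: lifts_to_def\<close>)
  then show "continuous_map (mtop M) (mtop M) F"
    using continuous_compose_quotient_map[OF quotient_map_quotient_topology] by (simp add: M_quot_def)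
next
  fix c c' assume "c \<in> atlas M" "c' \<in> atlas M"
  then obtain W W' where W: "slice W" "c = slice_chart W" "slice W'" "c' = slice_chart W'"
    by (auto simp: atlas_M)
  show "smooth_on (coord_dom F c c') (coord_rep F c c')"
    unfolding smooth_on_def
  proof (intro allI Ck_on_locally_affine)
    fix x assume "x \<in> coord_dom F c c'"
    then obtain t where t: "x \<in> W" "deck t (L x) \<in> W'"
      using coord_dom_slice[OF W(1) assms(1)] W by auto
    have "\<forall>y\<in>{y \<in> W. deck t (L y) \<in> W'}. coord_rep F c c' y = deck t (L y) + 0"
      using coord_rep_slice[OF W(1,3) assms(1)] W by simp
    moreover have "linear (\<lambda>y. deck t (L y))"
      using linear_compose[OF assms(2) linear_deck[of t]] by (simp add: o_def)
    ultimately show "\<exists>U L' c''. open U \<and> x \<in> U \<and> linear L' \<and> (\<forall>y\<in>U. coord_rep F c c' y = L' y + c'')"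
      using open_slice_vimage[OF W(1,3) assms(2), of t] t by blast
  qed
qed

subsection \<open>The conformal structure\<close>

text \<open>By the transformation rule, the components of a tensor field on the quotient in the slice
  charts are those of its pullback to the punctured space.\<close>

definition represents :: "((real ^ 'n) set, real ^ 'n) tensor2 \<Rightarrow>
    (real ^ 'n \<Rightarrow> real ^ 'n \<Rightarrow> real ^ 'n \<Rightarrow> real) \<Rightarrow> bool" where
  "represents g G \<longleftrightarrow> (\<forall>W x v w. slice W \<longrightarrow> x \<in> W \<longrightarrow> g (slice_chart W) x v w = G x v w)"

text \<open>Invariance under pullback: \<open>deck t\<close> is linear, hence its own derivative,
  and acts on tangent vectors by the same formula.\<close>

definition deck_invariant :: "(real ^ 'n \<Rightarrow> real ^ 'n \<Rightarrow> real ^ 'n \<Rightarrow> real) \<Rightarrow> bool" where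
  "deck_invariant G \<longleftrightarrow> (\<forall>t x v w. x \<noteq> 0 \<longrightarrow> G (deck t x) (deck t v) (deck t w) = G x v w)"

text \<open>In charts \<open>F\<close> is locally \<open>deck t\<close> after \<open>L\<close>, with
  the same map as derivative, and invariance of \<open>G\<close> removes \<open>deck t\<close>.
  Pullbacks on the quotient thus become one formula upstairs.\<close>

lemma is_pullback_descend_iff:
  assumes F: "lifts_to F L" and L: "linear L" "\<And>x. L x = 0 \<Longrightarrow> x = 0"
    and g': "represents g' G" "deck_invariant G"
  shows "is_pullback M M F g' g \<longleftrightarrow> represents g (\<lambda>x v w. G (L x) (L v) (L w))"
proof -
  have chart: "g' (slice_chart W') (coord_rep F (slice_chart W) (slice_chart W') x)
             (frechet_derivative (coord_rep F (slice_chart W) (slice_chart W')) (at x) v)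
             (frechet_derivative (coord_rep F (slice_chart W) (slice_chart W')) (at x) w)
      = G (L x) (L v) (L w)"
    if "slice W" "slice W'" "x \<in> W" "deck t (L x) \<in> W'" for W W' x t v w
  proof -
    have "L x \<noteq> 0" using that L(2) by (auto simp: slice_def)
    then show ?thesis
      using that g' coord_rep_slice[OF that(1,2) F that(3,4)]
        frechet_derivative_coord_rep_slice[OF that(1,2) F L(1) that(3,4)]
      by (simp add: represents_def deck_invariant_def)
  qed
  show ?thesis
  proof
    assume pb: "is_pullback M M F g' g"
    show "represents g (\<lambda>x v w. G (L x) (L v) (L w))"
      unfolding represents_def
    proof (intro allI impI)
      fix W x v w assume W: "slice W" "x \<in> W"
      then have "L x \<noteq> 0" using L(2) by (auto simp: slice_def)
      \<comment> \<open>A target slice around \<open>L x\<close> itself permits the translate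
        \<open>t = 0\<close>.\<close>
      then obtain W' where W': "slice W'" "L x \<in> W'" by (rule slice_around)
      then have t: "deck 0 (L x) \<in> W'" by simp
      then have "x \<in> coord_dom F (slice_chart W) (slice_chart W')"
        using coord_dom_slice[OF W(1) F] W by blast
      with pb W W' have "g (slice_chart W) x v w = g' (slice_chart W') (coord_rep F (slice_chart W) (slice_chart W') x)
             (frechet_derivative (coord_rep F (slice_chart W) (slice_chart W')) (at x) v)
             (frechet_derivative (coord_rep F (slice_chart W) (slice_chart W')) (at x) w)"
        unfolding is_pullback_def atlas_M by blast
      then show "g (slice_chart W) x v w = G (L x) (L v) (L w)"
        using chart[OF W(1) W'(1) W(2) t] by simp
    qed
  next
    assume g: "represents g (\<lambda>x v w. G (L x) (L v) (L w))"
    show "is_pullback M M F g' g"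
      unfolding is_pullback_def
    proof (intro ballI allI)
      fix c c' x v w assume "c \<in> atlas M" "c' \<in> atlas M" and x: "x \<in> coord_dom F c c'"
      then obtain W W' where W: "slice W" "c = slice_chart W" "slice W'" "c' = slice_chart W'"
        by (auto simp: atlas_M)
      then obtain t where t: "x \<in> W" "deck t (L x) \<in> W'"
        using coord_dom_slice[OF W(1) F] x by auto
      show "g c x v w = g' c' (coord_rep F c c' x)
             (frechet_derivative (coord_rep F c c') (at x) v)
             (frechet_derivative (coord_rep F c c') (at x) w)"
        using chart[OF W(1,3) t] g W t by (simp add: represents_def)
    qed
  qed
qed

text \<open>From the single chart of the punctured space to a slice chart, the projection is locally
  \<open>deck t\<close>. Taking \<open>t = 0\<close> will give the components upstairs, and
  comparing different \<open>t\<close> their invariance.\<close>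

lemma is_pullback_proj_iff:
  "is_pullback P M \<pi> g h \<longleftrightarrow>
     (\<forall>W t x v w. slice W \<longrightarrow> deck t x \<in> W \<longrightarrow>
        h (- {0}, id) x v w = g (slice_chart W) (deck t x) (deck t v) (deck t w))"
proof -
  have dom: "coord_dom \<pi> (- {0}, id) (slice_chart W) = {x. \<exists>t. deck t x \<in> W}" if "slice W" for W
    using that
    by (auto simp: coord_dom_def slice_chart_def slice_def proj_eq_iff image_iff) (metis deck_eq_0_iff)+
  have rep: "coord_rep \<pi> (- {0}, id) (slice_chart W) y = deck t y" if "slice W" "deck t y \<in> W" for W t y
  proof -
    have "y \<noteq> 0" using that by (metis deck_eq_0_iff slice_def)
    then have "inv_into (- {0}) id y = y"
      by (metis ComplI id_apply inj_on_id inv_into_f_f singletonD)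
    then show ?thesis
      using inv_into_slice[OF that] by (simp add: coord_rep_def chart_inv_def slice_chart_def)
  qed
  have der: "frechet_derivative (coord_rep \<pi> (- {0}, id) (slice_chart W)) (at x) = deck t"
    if "slice W" "deck t x \<in> W" for W t x
  proof -
    have "open (deck t -` W)"
      using that(1) by (auto intro!: open_vimage simp: slice_def linear_continuous_on linear_linear linear_deck)
    then have "(coord_rep \<pi> (- {0}, id) (slice_chart W) has_derivative deck t) (at x)"
      by (rule has_derivative_transform_within_open[OF linear_imp_has_derivative[OF linear_deck]])
        (use that rep in auto)
    then show ?thesis
      using frechet_derivative_at by metis
  qed
  show ?thesis
  proof (intro iffI allI impI)
    fix W t x v w
    assume pb: "is_pullback P M \<pi> g h" and W: "slice W" "deck t x \<in> W"
    then have "x \<in> coord_dom \<pi> (- {0}, id) (slice_chart W)"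
      by (auto simp: dom)
    with pb W(1) have "h (- {0}, id) x v w = g (slice_chart W) (coord_rep \<pi> (- {0}, id) (slice_chart W) x)
        (frechet_derivative (coord_rep \<pi> (- {0}, id) (slice_chart W)) (at x) v)
        (frechet_derivative (coord_rep \<pi> (- {0}, id) (slice_chart W)) (at x) w)"
      unfolding is_pullback_def atlas_P atlas_M by blast
    then show "h (- {0}, id) x v w = g (slice_chart W) (deck t x) (deck t v) (deck t w)"
      by (simp only: rep[OF W] der[OF W])
  next
    assume h: "\<forall>W t x v w. slice W \<longrightarrow> deck t x \<in> W \<longrightarrow>
      h (- {0}, id) x v w = g (slice_chart W) (deck t x) (deck t v) (deck t w)"
    show "is_pullback P M \<pi> g h"
      unfolding is_pullback_def
    proof (intro ballI allI)
      fix c c' x v w assume c: "c \<in> atlas P" and "c' \<in> atlas M" and x: "x \<in> coord_dom \<pi> c c'"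
      then obtain W where W: "slice W" "c' = slice_chart W"
        by (auto simp: atlas_M)
      have c: "c = (- {0}, id)" using c by (simp add: atlas_P)
      obtain t where t: "deck t x \<in> W"
        using x W(1) by (auto simp: c W(2) dom)
      show "h c x v w = g c' (coord_rep \<pi> c c' x)
          (frechet_derivative (coord_rep \<pi> c c') (at x) v)
          (frechet_derivative (coord_rep \<pi> c c') (at x) w)"
        using h W(1) t by (simp only: c W(2) rep[OF W(1) t] der[OF W(1) t])
    qed
  qed
qed

section \<open>Conformal metrics on the quotient and upstairs\<close>

lemma metric_on_punctured_space:
  assumes "pseudo_riemannian_metric P (\<lambda>_. G)" "x \<noteq> 0"
  shows "bilinear (G x)" "G x v w = G x w v" "(\<And>w. G x v w = 0) \<Longrightarrow> v = 0"
proof -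
  have "x \<in> chart_image (- {0}, id)"
    using assms(2) by simp
  then show "bilinear (G x)" "G x v w = G x w v" "(\<And>w. G x v w = 0) \<Longrightarrow> v = 0"
    using assms(1) unfolding pseudo_riemannian_metric_def atlas_P by blast+
qed

text \<open>This moves the conformal structure upstairs, where the charts of the quotient no longer
  appear: its metrics are the deck-invariant members of the class of \<open>g0\<close>.\<close>

lemma conf_quot_iff:
  "g \<in> conf_quot p q \<alpha> \<beta> \<iota> \<longleftrightarrow>
     (\<exists>G. represents g G \<and> deck_invariant G \<and> (\<lambda>_. G) \<in> conformal_class P (g0 p q \<iota>))"
proof
  assume "g \<in> conf_quot p q \<alpha> \<beta> \<iota>"
  then obtain h where h: "h \<in> conformal_class P (g0 p q \<iota>)" "is_pullback P M \<pi> g h"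
    by (auto simp: conf_quot_def)
  define G where "G = h (- {0}, id)"
  have G: "G x v w = g (slice_chart W) (deck t x) (deck t v) (deck t w)"
    if "slice W" "deck t x \<in> W" for W t x v w
    using h(2) that unfolding is_pullback_proj_iff G_def by blast
  have rep: "represents g G"
    unfolding represents_def using G[of _ 0] by simp
  moreover have "deck_invariant G"
    unfolding deck_invariant_def
  proof (intro allI impI)
    fix t v w and x :: "real ^ 'n" assume "x \<noteq> 0"
    then obtain W where "slice W" "deck t x \<in> W"
      using slice_around[of "deck t x"] by auto
    then show "G (deck t x) (deck t v) (deck t w) = G x v w"
      using G rep by (simp add: represents_def)
  qed
  \<comment> \<open>Dropping the chart argument is harmless: the punctured space has a single
    chart.\<close>
  moreover have "(\<lambda>_. G) \<in> conformal_class P (g0 p q \<iota>)"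
    using h(1) by (simp add: conformal_class_def pseudo_riemannian_metric_def is_pullback_def atlas_P G_def g0_def)
  ultimately show "\<exists>G. represents g G \<and> deck_invariant G \<and> (\<lambda>_. G) \<in> conformal_class P (g0 p q \<iota>)"
    by blast
next
  assume "\<exists>G. represents g G \<and> deck_invariant G \<and> (\<lambda>_. G) \<in> conformal_class P (g0 p q \<iota>)"
  then obtain G where G: "represents g G" "deck_invariant G" "(\<lambda>_. G) \<in> conformal_class P (g0 p q \<iota>)"
    by blast
  have metric: "pseudo_riemannian_metric P (\<lambda>_. G)"
    using G(3) by (simp add: conformal_class_def)
  have rep: "g (slice_chart W) x = G x" if "slice W" "x \<in> W" for W x
    by (intro ext) (use G(1) that in \<open>auto simp: represents_def\<close>)
  have "is_pullback P M \<pi> g (\<lambda>_. G)"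
    unfolding is_pullback_proj_iff
  proof (intro allI impI)
    fix W t x v w assume W: "slice W" "deck t x \<in> W"
    then have "x \<noteq> 0" by (metis deck_eq_0_iff slice_def)
    with W G(2) show "G x v w = g (slice_chart W) (deck t x) (deck t v) (deck t w)"
      by (simp add: rep deck_invariant_def)
  qed
  moreover have "pseudo_riemannian_metric M g"
    unfolding pseudo_riemannian_metric_def
  proof (intro conjI ballI allI)
    fix c x assume "c \<in> atlas M" and x: "x \<in> chart_image c"
    then obtain W where W: "slice W" "c = slice_chart W"
      by (auto simp: atlas_M)
    with x have "x \<in> W" by (simp add: chart_image_slice)
    then have eq: "g c x = G x" and "x \<noteq> 0"
      using W by (auto simp: rep slice_def)
    show "bilinear (g c x)"
      unfolding eq using metric \<open>x \<noteq> 0\<close> by (rule metric_on_punctured_space)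
    show "g c x v w = g c x w v" for v w
      unfolding eq using metric \<open>x \<noteq> 0\<close> by (rule metric_on_punctured_space)
    show "(\<forall>w. g c x v w = 0) \<longrightarrow> v = 0" for v
      unfolding eq using metric_on_punctured_space(3)[OF metric \<open>x \<noteq> 0\<close>] by blast
  next
    fix c v w assume "c \<in> atlas M"
    then obtain W where W: "slice W" "c = slice_chart W"
      by (auto simp: atlas_M)
    then have "open W" "W \<subseteq> - {0}" by (auto simp: slice_def)
    have "Ck_on k (- {0}) (\<lambda>x. G x v w)" for k
      using metric by (simp add: pseudo_riemannian_metric_def atlas_P smooth_on_def)
    then have "Ck_on k W (\<lambda>x. G x v w)" for k
      using \<open>W \<subseteq> - {0}\<close> by (rule Ck_on_subset)
    then have "Ck_on k W (\<lambda>x. g c x v w)" for k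
      by (rule Ck_on_cong[OF \<open>open W\<close>, rotated]) (simp add: W rep)
    then show "smooth_on (chart_image c) (\<lambda>x. g c x v w)"
      using W by (simp add: smooth_on_def chart_image_slice)
  next
    \<comment> \<open>The transformation rule between slices is the descent criterion for the
      identity, lifted by the identity.\<close>
    show "is_pullback M M id g g"
      using is_pullback_descend_iff[of id "\<lambda>x. x" g G g] G by (simp add: linear_ident lifts_to_def)
  qed
  ultimately show "g \<in> conf_quot p q \<alpha> \<beta> \<iota>"
    using G(3) by (auto simp: conf_quot_def)
qed

text \<open>Pulling back \<open>exp (2 * \<sigma>)\<close> times \<open>g0\<close> composes \<sigma>
  with a linear map and multiplies by the constant of \<open>g0_phi\<close>; the metric axioms
  transfer along the linear isomorphism.\<close>

lemma conformal_class_phi: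
  assumes "(\<lambda>_. G) \<in> conformal_class P (g0 p q \<iota>)"
  shows "(\<lambda>_ x v w. G (\<Phi> a b x) (\<Phi> a b v) (\<Phi> a b w)) \<in> conformal_class P (g0 p q \<iota>)"
proof -
  let ?G = "\<lambda>x v w. G (\<Phi> a b x) (\<Phi> a b v) (\<Phi> a b w)"
  have inv_id: "chart_inv (- {0}, id) x = x" if "x \<noteq> 0" for x :: "real ^ 'n"
    using that inv_into_f_f[of id "- {0}" x] by (simp add: chart_inv_def)
  have op: "open (- {0 :: real ^ 'n})" by (intro open_Compl closed_singleton)
  have metric: "pseudo_riemannian_metric P (\<lambda>_. G)"
    using assms by (simp add: conformal_class_def)
  obtain \<sigma> where "smooth_fun P \<sigma>"
    and \<sigma>: "\<And>x v w. x \<noteq> 0 \<Longrightarrow>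
      G x v w = exp (2 * \<sigma> (chart_inv (- {0}, id) x)) * g0 p q \<iota> (- {0}, id) x v w"
    using assms by (auto simp: conformal_class_def atlas_P)
  have smooth_\<sigma>: "Ck_on k (- {0}) \<sigma>" for k
    by (rule Ck_on_cong[OF op, of "\<sigma> \<circ> chart_inv (- {0}, id)"])
      (use \<open>smooth_fun P \<sigma>\<close> inv_id in \<open>auto simp: smooth_fun_def smooth_on_def atlas_P\<close>)
  \<comment> \<open>The summand \<open>a + b\<close> is half the exponent of the homothety
    factor.\<close>
  define \<tau> where "\<tau> = (\<lambda>x. \<sigma> (\<Phi> a b x) + (a + b))"
  have im: "\<Phi> a b ` (- {0}) \<subseteq> - {0}" by auto
  have smooth_\<tau>: "Ck_on k (- {0}) \<tau>" for k
    unfolding \<tau>_def by (intro Ck_on_add_const Ck_on_compose_linear[OF linear_phi im op] smooth_\<sigma>)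
  have "Ck_on k (- {0}) (\<tau> \<circ> chart_inv (- {0}, id))" for k
    by (rule Ck_on_cong[OF op _ smooth_\<tau>]) (simp add: inv_id)
  then have "smooth_fun P \<tau>"
    by (simp add: smooth_fun_def smooth_on_def atlas_P)
  moreover have "?G x v w = exp (2 * \<tau> (chart_inv (- {0}, id) x)) * g0 p q \<iota> (- {0}, id) x v w"
    if "x \<noteq> 0" for x v w
  proof -
    have "?G x v w = exp (2 * \<sigma> (\<Phi> a b x)) * (exp (2 * (a + b)) * g0 p q \<iota> (- {0}, id) x v w)"
      using \<sigma>[of "\<Phi> a b x"] that g0_phi[OF bij_coords' card_n] p_ge p_le_q by (simp add: inv_id)
    then show ?thesis
      using that by (simp add: inv_id \<tau>_def exp_add distrib_left)
  qed
  moreover have "pseudo_riemannian_metric P (\<lambda>_. ?G)"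
    unfolding pseudo_riemannian_metric_def
  proof (intro conjI ballI allI)
    fix c and x :: "real ^ 'n" assume "c \<in> atlas P" "x \<in> chart_image c"
    then have "x \<noteq> 0" by (simp add: atlas_P)
    then have "\<Phi> a b x \<noteq> 0" by simp
    note at_phi = metric_on_punctured_space[OF metric this]
    show "bilinear (?G x)"
      using at_phi(1) linear_compose[OF linear_phi[of a b \<iota>], unfolded o_def]
      unfolding bilinear_def by blast
    show "?G x v w = ?G x w v" for v w
      by (rule at_phi)
    \<comment> \<open>Nondegeneracy uses surjectivity: every test vector is the image of its
      preimage under the inverse diagonal map.\<close>
    show "(\<forall>w. ?G x v w = 0) \<longrightarrow> v = 0" for v
      using at_phi(3)[of "\<Phi> a b v"] by (metis phi_cancel(2) phi_eq_0_iff)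
  next
    fix c v w assume "c \<in> atlas P"
    have "Ck_on k (- {0}) (\<lambda>x. G x (\<Phi> a b v) (\<Phi> a b w))" for k
      using metric by (simp add: pseudo_riemannian_metric_def atlas_P smooth_on_def)
    then have "Ck_on k (- {0}) (\<lambda>x. ?G x v w)" for k
      by (rule Ck_on_compose_linear[OF linear_phi im op])
    with \<open>c \<in> atlas P\<close> show "smooth_on (chart_image c) (\<lambda>x. ?G x v w)"
      by (simp add: smooth_on_def atlas_P)
  next
    have "frechet_derivative (coord_rep id (- {0}, id) (- {0}, id)) (at x) = (\<lambda>v. v)"
      "coord_rep id (- {0}, id) (- {0}, id) x = x" if "x \<noteq> 0" for x :: "real ^ 'n"
    proof -
      have "frechet_derivative (coord_rep id (- {0}, id) (- {0}, id)) (at x) = frechet_derivative (\<lambda>x. x) (at x)"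
        by (rule frechet_derivative_cong_open[OF op]) (use that inv_id in \<open>auto simp: coord_rep_def\<close>)
      then show "frechet_derivative (coord_rep id (- {0}, id) (- {0}, id)) (at x) = (\<lambda>v. v)"
        by simp
      show "coord_rep id (- {0}, id) (- {0}, id) x = x"
        using that inv_id by (simp add: coord_rep_def)
    qed
    then show "is_pullback P P id (\<lambda>_. ?G) (\<lambda>_. ?G)"
      unfolding is_pullback_def atlas_P by (auto simp: coord_dom_def)
  qed
  ultimately show ?thesis
    unfolding conformal_class_def
    by (intro CollectI conjI exI[of _ \<tau>]) (simp_all only: atlas_P ball_simps, simp)
qed

subsection \<open>Conformal maps induced by the commuting diagonal maps\<close>

text \<open>Points of the quotient are sets of vectors, so the induced map is the direct image; it
  respects orbits because diagonal maps commute.\<close>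

lemma phi_image_proj: "image (\<Phi> a b) (\<pi> x) = \<pi> (\<Phi> a b x)"
  by (simp add: proj_eq image_image deck_phi)

lemma deck_invariant_phi:
  assumes "deck_invariant G"
  shows "deck_invariant (\<lambda>x v w. G (\<Phi> a b x) (\<Phi> a b v) (\<Phi> a b w))"
  using assms by (simp add: deck_invariant_def deck_phi[symmetric])

text \<open>The inverse is induced by the parameters \<open>- a\<close>, \<open>- b\<close>, so
  descent gives smoothness both ways, and \<open>conformal_class_phi\<close> for both signs gives
  the two inclusions of classes.\<close>

lemma image_phi_in_conformal_group:
  "image (\<Phi> a b) \<in> conformal_group M (conf_quot p q \<alpha> \<beta> \<iota>)"
proof -
  let ?C = "conf_quot p q \<alpha> \<beta> \<iota>" and ?F = "image (\<Phi> a b)"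
  let ?pull = "\<lambda>a b G x v w. G (\<Phi> a b x) (\<Phi> a b v) (\<Phi> a b w)"
  have pb: "is_pullback M M ?F g' g \<longleftrightarrow> represents g (?pull a b G)"
    if "represents g' G" "deck_invariant G" for g' g G
    using that by (intro is_pullback_descend_iff) (auto simp: lifts_to_def phi_image_proj linear_phi)
  have cancel: "image (\<Phi> (- a) (- b)) (image (\<Phi> a b) S) = S" "image (\<Phi> a b) (image (\<Phi> (- a) (- b)) S) = S" for S
    by (simp_all add: image_image)
  have im: "image (\<Phi> a b) ` topspace (mtop M) \<subseteq> topspace (mtop M)" for a b
    by (auto simp: topspace_M phi_image_proj intro!: imageI)
  have bij: "bij_betw ?F (topspace (mtop M)) (topspace (mtop M))"
    by (rule bij_betw_byWitness[where f' = "image (\<Phi> (- a) (- b))"]) (use cancel im in auto)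
  have "inv_into (topspace (mtop M)) ?F (\<pi> x) = \<pi> (\<Phi> (- a) (- b) x)" if "x \<noteq> 0" for x
  proof (rule inv_into_f_eq)
    show "inj_on ?F (topspace (mtop M))"
      using bij by (simp add: bij_betw_def)
    show "\<pi> (\<Phi> (- a) (- b) x) \<in> topspace (mtop M)"
      using that by (simp add: topspace_M)
    show "?F (\<pi> (\<Phi> (- a) (- b) x)) = \<pi> x"
      by (simp add: phi_image_proj)
  qed
  then have "smooth_map M M (inv_into (topspace (mtop M)) ?F)"
    by (intro smooth_map_descend[of _ "\<Phi> (- a) (- b)"]) (auto simp: lifts_to_def linear_phi)
  moreover have "smooth_map M M ?F"
    by (rule smooth_map_descend[of _ "\<Phi> a b"]) (auto simp: lifts_to_def linear_phi phi_image_proj)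
  moreover have "pullback_class M M ?F ?C = ?C"
  proof (intro equalityI subsetI)
    fix g assume "g \<in> pullback_class M M ?F ?C"
    then obtain g' G where "is_pullback M M ?F g' g" "represents g' G" "deck_invariant G"
      and "(\<lambda>_. G) \<in> conformal_class P (g0 p q \<iota>)"
      by (auto simp: pullback_class_def conf_quot_iff)
    then show "g \<in> ?C"
      unfolding conf_quot_iff using pb deck_invariant_phi conformal_class_phi by blast
  next
    fix g assume "g \<in> ?C"
    then obtain G where G: "represents g G" "deck_invariant G" "(\<lambda>_. G) \<in> conformal_class P (g0 p q \<iota>)"
      by (auto simp: conf_quot_iff)
    \<comment> \<open>The pullback by the inverse serves as the required preimage of
      \<open>g\<close>; used in every chart, it defines a tensor on the quotient.\<close>
    define G' where "G' = ?pull (- a) (- b) G"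
    have G': "represents (\<lambda>_. G') G'" "deck_invariant G'" "(\<lambda>_. G') \<in> conformal_class P (g0 p q \<iota>)"
      using G deck_invariant_phi conformal_class_phi by (auto simp: represents_def G'_def)
    then have "(\<lambda>_. G') \<in> ?C"
      unfolding conf_quot_iff by blast
    moreover have "is_pullback M M ?F (\<lambda>_. G') g"
      unfolding pb[OF G'(1,2)] using G(1) by (simp add: G'_def)
    ultimately show "g \<in> pullback_class M M ?F ?C"
      by (auto simp: pullback_class_def)
  qed
  ultimately show ?thesis
    using bij by (simp add: conformal_group_def diffeomorphism_def)
qed

subsection \<open>A wandering open set\<close>

text \<open>In logarithms this is a box with sides 2 and -3\<alpha>: the step of
  \<open>\<Phi> 0 1\<close> in the first coordinate and of the deck generator, up to sign, in the
  second.\<close>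

definition wanderer :: "(real ^ 'n) set" where
  "wanderer = {x. 1 < x $ \<iota> 1 \<and> x $ \<iota> 1 < exp 2 \<and> 1 < x $ \<iota> 2 \<and> x $ \<iota> 2 < exp (- 3 * \<alpha>)}"

lemma open_wanderer: "open wanderer"
  unfolding wanderer_def by (intro open_Collect_conj open_Collect_less continuous_intros)

lemma zero_notin_wanderer: "0 \<notin> wanderer"
  by (simp add: wanderer_def)

lemma wanderer_nonempty: "wanderer \<noteq> {}"
proof -
  have "1 \<in> {1..p + q}" "2 \<in> {1..p + q}" using p_ge by auto
  then have ne: "\<iota> 1 \<noteq> \<iota> 2"
    using bij_coords inj_onD[of \<iota> "{1..p + q}" 1 2] by (auto simp: bij_betw_def)
  \<comment> \<open>The logarithms of the two relevant coordinates are the midpoints 1 and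
    -3\<alpha>/2 of the sides.\<close>
  define x :: "real ^ 'n" where "x = (\<chi> i. if i = \<iota> 1 then exp 1 else exp (- 3 * \<alpha> / 2))"
  have "x \<in> wanderer"
    using ne less by (simp add: wanderer_def x_def)
  then show ?thesis by blast
qed

text \<open>The second coordinate is fixed by \<open>\<Phi> 0 1\<close>, so it alone forces
  \<open>t = 0\<close>; then the first, moved by 2 in logarithm at each step, forces
  \<open>k = 0\<close>.\<close>

lemma wandering:
  assumes "u \<in> wanderer" "\<Phi> 0 (real k) u = deck t u'" "u' \<in> wanderer"
  shows "k = 0"
proof -
  have one: "1 \<in> {1..CARD('n)}" and two: "2 \<in> {1..CARD('n)}"
    using p_ge card_n by auto
  note nth1 = phi_nth[OF bij_coords' one] and nth2 = phi_nth[OF bij_coords' two]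
  note pos = less_trans[OF zero_less_one]
  define r s r' s' where defs: "r = ln (u $ \<iota> 1)" "s = ln (u $ \<iota> 2)" "r' = ln (u' $ \<iota> 1)" "s' = ln (u' $ \<iota> 2)"
  have exps: "u $ \<iota> 1 = exp r" "u $ \<iota> 2 = exp s" "u' $ \<iota> 1 = exp r'" "u' $ \<iota> 2 = exp s'"
    using assms(1,3) by (auto simp: defs wanderer_def intro: pos)
  have bounds: "0 < r" "r < 2" "0 < s" "s < - 3 * \<alpha>" "0 < r'" "r' < 2" "0 < s'" "s' < - 3 * \<alpha>"
    using assms(1,3) unfolding wanderer_def mem_Collect_eq exps exp_less_cancel_iff one_less_exp_iff by simp_all
  have "\<Phi> 0 (real k) u $ \<iota> 1 = deck t u' $ \<iota> 1" "\<Phi> 0 (real k) u $ \<iota> 2 = deck t u' $ \<iota> 2"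
    using assms(2) by simp_all
  then have eqs: "2 * real k + r = of_int t * (2 * \<beta> - \<alpha>) + r'" "s = of_int t * (3 * \<alpha>) + s'"
    unfolding deck_def nth1 nth2 exps exp_add[symmetric] exp_inj_iff
    by (simp_all add: weight_def algebra_simps)
  \<comment> \<open>The left side is \<open>s - s'\<close>, a difference of two points of an
    interval of length -3\<alpha>.\<close>
  have "of_int t * (3 * \<alpha>) < - 1 * (3 * \<alpha>)" "1 * (3 * \<alpha>) < of_int t * (3 * \<alpha>)"
    using bounds eqs(2) by linarith+
  with less have "(of_int t :: real) < 1" "- 1 < (of_int t :: real)"
    unfolding mult_less_cancel_right by auto
  then have "t = 0" by linarith
  \<comment> \<open>Now \<open>2 * real k\<close> is \<open>r' - r\<close>, which is less than
    2.\<close>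
  with eqs(1) bounds have "real k < 1" by simp
  then show ?thesis by simp
qed

end

section \<open>Recurrence\<close>

text \<open>Poincare recurrence: the preimages of \<open>A\<close> under the iterates are pairwise
  disjoint and all have the measure of \<open>A\<close>, so in a finite measure space that measure
  is zero.\<close>

lemma emeasure_wandering_set:
  assumes "finite_measure \<mu>" "preserves_measure \<mu> f" "A \<in> sets \<mu>"
    and wander: "\<And>x k. x \<in> A \<Longrightarrow> (f ^^ k) x \<in> A \<Longrightarrow> k = 0"
  shows "emeasure \<mu> A = 0"
proof -
  interpret finite_measure \<mu> by fact
  have f: "f \<in> measurable \<mu> \<mu>" and distr: "distr \<mu> \<mu> f = \<mu>"
    using assms(2) by (auto simp: preserves_measure_def)
  have fn: "f ^^ n \<in> measurable \<mu> \<mu>" for n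
    by (induction n) (use f in \<open>auto intro: measurable_compose simp: o_def\<close>)
  have distr_n: "distr \<mu> \<mu> (f ^^ n) = \<mu>" for n
  proof (induction n)
    case 0
    then show ?case by (simp add: id_def)
  next
    case (Suc n)
    have "distr \<mu> \<mu> (f ^^ Suc n) = distr (distr \<mu> \<mu> (f ^^ n)) \<mu> f"
      using distr_distr[OF f fn[of n]] by simp
    with Suc distr show ?case by (simp add: o_def)
  qed
  define B where "B n = (f ^^ n) -` A \<inter> space \<mu>" for n
  have B: "B n \<in> sets \<mu>" "emeasure \<mu> (B n) = emeasure \<mu> A" for n
  proof -
    show "B n \<in> sets \<mu>"
      unfolding B_def using fn assms(3) by (rule measurable_sets)
    show "emeasure \<mu> (B n) = emeasure \<mu> A"
      unfolding B_def using emeasure_distr[OF fn[of n] assms(3)] distr_n[of n] by simp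
  qed
  \<comment> \<open>A common point of two preimages gives a point of \<open>A\<close> that returns
    to \<open>A\<close> after \<open>n - m\<close> steps.\<close>
  have ordered: "m = n" if "x \<in> B m" "x \<in> B n" "m \<le> n" for x m n
  proof -
    have "(f ^^ (n - m)) ((f ^^ m) x) = (f ^^ n) x"
      using that(3) by (metis comp_apply funpow_add le_add_diff_inverse2)
    moreover have "(f ^^ m) x \<in> A" "(f ^^ n) x \<in> A"
      using that(1,2) unfolding B_def by blast+
    ultimately have "n - m = 0"
      by (metis wander)
    with that(3) show ?thesis by simp
  qed
  have disj: "disjoint_family B"
    unfolding disjoint_family_on_def
  proof (intro ballI impI equals0I)
    fix m n x assume "m \<noteq> n" "x \<in> B m \<inter> B n"
    then show False
      using ordered[of x m n] ordered[of x n m] by (cases "m \<le> n") auto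
  qed
  have "(\<lambda>n. measure \<mu> (B n)) sums measure \<mu> (\<Union>n. B n)"
    using B(1) disj by (intro finite_measure_UNION) auto
  \<comment> \<open>Countable additivity makes a constant series converge, which forces the constant
    to be zero.\<close>
  then have "summable (\<lambda>n::nat. measure \<mu> A)"
    using B(2) by (simp add: measure_def sums_iff)
  then have "measure \<mu> A = 0"
    by (simp add: summable_const_iff)
  then show ?thesis
    by (simp add: emeasure_eq_measure)
qed

section \<open>Vanishing of an invariant measure on a wandering open set\<close>

theorem mainTheorem2:
  fixes p q :: nat and \<alpha> \<beta> :: real and \<iota> :: "nat \<Rightarrow> 'n::finite"
  assumes "2 \<le> p" and "p \<le> q"
    and "CARD('n) = p + q" and "bij_betw \<iota> {1..p + q} (UNIV :: 'n set)"
    and "\<alpha> < \<beta>" and "\<beta> < \<alpha> / 2" and "\<alpha> / 2 < 0"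
  shows "\<not> (\<exists>\<mu>. borel_measure_on (mtop (M_quot \<alpha> \<beta> \<iota>)) \<mu> \<and> finite_measure \<mu> \<and>
              (\<forall>U. openin (mtop (M_quot \<alpha> \<beta> \<iota>)) U \<and> U \<noteq> {} \<longrightarrow> emeasure \<mu> U \<noteq> 0) \<and>
              (\<forall>f \<in> conformal_group (M_quot \<alpha> \<beta> \<iota>) (conf_quot p q \<alpha> \<beta> \<iota>).
                 preserves_measure \<mu> f))"
proof
  interpret conformal_quotient p q \<alpha> \<beta> \<iota>
    by unfold_locales (use assms in auto)
  let ?U = "\<pi> ` wanderer" and ?f = "image (\<Phi> 0 1)"
  have "openin (mtop M) ?U"
    using open_wanderer zero_notin_wanderer by (rule openin_M_proj)
  assume "\<exists>\<mu>. borel_measure_on (mtop M) \<mu> \<and> finite_measure \<mu> \<and>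
              (\<forall>U. openin (mtop M) U \<and> U \<noteq> {} \<longrightarrow> emeasure \<mu> U \<noteq> 0) \<and>
              (\<forall>f \<in> conformal_group M (conf_quot p q \<alpha> \<beta> \<iota>). preserves_measure \<mu> f)"
  then obtain \<mu> where \<mu>: "borel_measure_on (mtop M) \<mu>" "finite_measure \<mu>" "preserves_measure \<mu> ?f"
    and pos: "emeasure \<mu> ?U \<noteq> 0"
    using \<open>openin (mtop M) ?U\<close> wanderer_nonempty image_phi_in_conformal_group by blast
  have "?U \<in> sets \<mu>"
  proof -
    have "{U. openin (mtop M) U} \<subseteq> Pow (topspace (mtop M))"
      using openin_subset by blast
    then show ?thesis
      using \<mu>(1) \<open>openin (mtop M) ?U\<close>
      by (simp add: borel_measure_on_def sets_measure_of sigma_sets.Basic)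
  qed
  have pow: "(?f ^^ k) (\<pi> x) = \<pi> (\<Phi> 0 (real k) x)" for k x
    by (induction k) (simp_all add: phi_image_proj phi_add[symmetric])
  have "emeasure \<mu> ?U = 0"
    using \<mu>(2,3) \<open>?U \<in> sets \<mu>\<close>
  proof (rule emeasure_wandering_set)
    fix S k assume "S \<in> ?U" and "(?f ^^ k) S \<in> ?U"
    \<comment> \<open>A return in the quotient is a return upstairs only up to a deck
      transformation, which is the \<open>t\<close> allowed for in \<open>wandering\<close>.\<close>
    then obtain u u' where u: "u \<in> wanderer" "u' \<in> wanderer" "\<pi> u' = \<pi> (\<Phi> 0 (real k) u)"
      by (auto simp: pow)
    then show "k = 0"
      unfolding proj_eq_iff using wandering by blast
  qed
  with pos show False ..
qed

end
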